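(* Let $T$ be a tree of order $n$. Then $$\sigma_1(T)+\sigma_1(\overline{T})\ \ge\ (n-1)^2,$$ with equality if and only if $T\cong K_{1,n-1}$.
   Context: All graphs are finite, simple and undirected, with nonempty vertex set; the order of a graph is its number of vertices. $\overline{T}$ denotes the complement of $T$ (same vertex set, two distinct vertices being adjacent in $\overline{T}$ iff they are not adjacent in $T$). $K_{1,n-1}$ is the star on $n$ vertices, i.e. the complete bipartite graph with partite sets of sizes $1$ and $n-1$ (for $n=1$ it is the single-vertex graph). A subset $S\subseteq V(G)$ of the vertices of a graph $G$ is called a $1$-nearly independent vertex subset of $G$ if the subgraph of $G$ induced by $S$ contains exactly one edge; $\sigma_1(G)$ denotes the number of $1$-nearly independent vertex subsets of $G$. *)

theory Defs
  imports "Graph_Theory.Graph_Theory"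
begin

text \<open>
  A finite simple undirected graph is a \<open>pair_graph\<close>: a finite, loop-free, symmetric relation on
  a finite vertex set, each undirected edge being a pair of opposite arcs.
\<close>

definition undirected_edges :: "('a, 'b) pre_digraph \<Rightarrow> 'a set set" where
  "undirected_edges G = (\<lambda>e. {tail G e, head G e}) ` arcs G"

text \<open>
  The library predicate \<open>tree\<close> is unsuitable for symmetric digraphs: a pair of opposite arcs is a
  \<open>cycle\<close> of length 2 there. The cycles of the undirected graph are those of length at least 3.
  Nonemptiness of the vertex set is part of \<open>connected\<close>.
\<close>

definition undirected_tree :: "'a pair_pre_digraph \<Rightarrow> bool" where
  "undirected_tree G \<longleftrightarrow> pair_graph G \<and> Digraph_Component.connected (with_proj G) \<and>
     \<not> (\<exists>p. pre_digraph.cycle (with_proj G) p \<and> 3 \<le> length p)"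

definition complement :: "'a pair_pre_digraph \<Rightarrow> 'a pair_pre_digraph" where
  "complement G = \<lparr> pverts = pverts G,
     parcs = {(u, v). u \<in> pverts G \<and> v \<in> pverts G \<and> u \<noteq> v \<and> (u, v) \<notin> parcs G} \<rparr>"

text \<open>
  The library has \<open>K\<^bsub>m,n\<^esub>\<close> only as a predicate; this is a concrete representative.
\<close>

definition complete_bipartite :: "nat \<Rightarrow> nat \<Rightarrow> (nat + nat) pair_pre_digraph" where
  "complete_bipartite m n = (let U = Inl ` {..<m}; V = Inr ` {..<n} in
     \<lparr> pverts = U \<union> V, parcs = U \<times> V \<union> V \<times> U \<rparr>)"

definition one_nearly_independent :: "'a pair_pre_digraph \<Rightarrow> 'a set \<Rightarrow> bool" where
  "one_nearly_independent G S \<longleftrightarrow>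
     S \<subseteq> pverts G \<and> card (undirected_edges (with_proj G \<restriction> S)) = 1"

definition sigma1 :: "'a pair_pre_digraph \<Rightarrow> nat" where
  "sigma1 G = card {S. one_nearly_independent G S}"

lemma pair_graph_complement:
  assumes "pair_graph G"
  shows "pair_graph (complement G)"
proof -
  interpret pair_graph G by fact
  have "finite (pverts G \<times> pverts G)" by simp
  then have "finite (parcs (complement G))"
    by (rule finite_subset[rotated]) (auto simp: complement_def)
  moreover have "sym (parcs (complement G))"
    using arcs_symmetric by (auto simp: complement_def sym_def)
  ultimately show ?thesis
    by unfold_locales
      (auto simp: complement_def symmetric_def arcs_ends_def arc_to_ends_def image_def)
qed

lemma complete_bipartite_graph: "K\<^bsub>m,n\<^esub> (with_proj (complete_bipartite m n))"
proof -
  let ?G = "complete_bipartite m n"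
  have "pair_graph ?G"
    by unfold_locales
      (auto simp: complete_bipartite_def Let_def symmetric_def arcs_ends_def arc_to_ends_def
        image_def sym_def)
  then have "graph (with_proj ?G)"
    by (rule pair_graph.pair_graphD_graph)
  moreover have "verts (with_proj ?G) = Inl ` {..<m} \<union> Inr ` {..<n}"
    "arcs_ends (with_proj ?G) = Inl ` {..<m} \<times> Inr ` {..<n} \<union> Inr ` {..<n} \<times> Inl ` {..<m}"
    by (auto simp: complete_bipartite_def Let_def arcs_ends_def arc_to_ends_def image_def)
  moreover have "Inl ` {..<m} \<inter> Inr ` {..<n} = {}"
    "card (Inl ` {..<m} :: (nat + nat) set) = m" "card (Inr ` {..<n} :: (nat + nat) set) = n"
    by (auto simp: card_image)
  ultimately show ?thesis
    unfolding complete_bipartite_digraph_def by blast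
qed

end

theory Submission
  imports Defs
begin

text \<open>
  The subsets of size 2 counted by \<open>sigma1 T\<close> and \<open>sigma1 (complement T)\<close> are the edges and the
  non-edges, \<open>n choose 2\<close> in total. A triple is counted iff it spans one or two edges, since a tree
  has no triangle. Let \<open>t\<^sub>1\<close> and \<open>t\<^sub>2\<close> be the numbers of triples spanning one and two edges. Counting
  pairs of an edge and a further vertex gives \<open>t\<^sub>1 + 2 t\<^sub>2 = (n - 1) (n - 2)\<close>, so
  \<open>t\<^sub>1 + t\<^sub>2 \<ge> (n - 1 choose 2)\<close> and the bound follows. Equality forces \<open>t\<^sub>1 = 0\<close>, that is,
  every vertex off an edge is adjacent to an end of it; as there are no cycles of length 3 or 4, the
  tree is then a star. Conversely \<open>t\<^sub>1 = 0\<close> for a star, and \<open>t\<^sub>1 = 0\<close> implies that no set of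
  size at least 4 is counted: a set with exactly one edge contains such a triple, and a set of size
  at least 4 with exactly one non-edge contains a triangle.
\<close>

section \<open>Sets spanning exactly one edge\<close>

definition pairs :: "'a set \<Rightarrow> 'a set set" where
  "pairs V = {e. e \<subseteq> V \<and> card e = 2}"

definition triples :: "'a set \<Rightarrow> 'a set set" where
  "triples V = {t. t \<subseteq> V \<and> card t = 3}"

definition spanned :: "'a set set \<Rightarrow> 'a set \<Rightarrow> nat" where
  "spanned E S = card {e \<in> E. e \<subseteq> S}"

definition one_edge_sets :: "'a set \<Rightarrow> 'a set set \<Rightarrow> 'a set set" where
  "one_edge_sets V E = {S. S \<subseteq> V \<and> spanned E S = 1}"

lemma card_pairs: "finite V \<Longrightarrow> card (pairs V) = card V choose 2"
  unfolding pairs_def by (rule n_subsets)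

lemma pairsE:
  assumes "e \<in> pairs V"
  obtains a b where "e = {a, b}" "a \<noteq> b" "a \<in> V" "b \<in> V"
  using assms unfolding pairs_def by (auto simp: card_2_iff)

lemma triplesE:
  assumes "t \<in> triples V"
  obtains a b c where "t = {a, b, c}" "a \<noteq> b" "a \<noteq> c" "b \<noteq> c" "a \<in> V" "b \<in> V" "c \<in> V"
  using assms unfolding triples_def by (auto simp: card_3_iff)

lemma insert_in_triples: "e \<in> pairs V \<Longrightarrow> w \<in> V \<Longrightarrow> w \<notin> e \<Longrightarrow> insert w e \<in> triples V"
  unfolding pairs_def triples_def by (auto simp: card_insert_if card_ge_0_finite)

text \<open>Working with a bare edge set lets every fact proved here be used both for
  \<open>E\<close> and for the non-edges \<open>pairs V - E\<close>.\<close>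

locale edge_set =
  fixes V :: "'a set" and E :: "'a set set"
  assumes finite_V: "finite V" and E_pairs: "E \<subseteq> pairs V"
begin

lemma finite_pairs: "finite (pairs V)"
  using finite_V by (simp add: pairs_def)

lemma finite_E: "finite E"
  using finite_subset[OF E_pairs finite_pairs] .

lemma finite_triples: "finite (triples V)"
  using finite_V by (simp add: triples_def)

lemma spanned_pair:
  assumes "e \<in> pairs V"
  shows "spanned E e = (if e \<in> E then 1 else 0)"
proof -
  have "f = e" if "f \<in> E" "f \<subseteq> e" for f
    using that assms E_pairs by (intro card_subset_eq) (auto simp: pairs_def intro: card_ge_0_finite)
  then have "{f \<in> E. f \<subseteq> e} = (if e \<in> E then {e} else {})" by auto
  then show ?thesis by (simp add: spanned_def)
qed

lemma spanned_mono: "S \<subseteq> S' \<Longrightarrow> spanned E S \<le> spanned E S'"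
  unfolding spanned_def using finite_E by (intro card_mono) auto

text \<open>A triple contains exactly three pairs, and each of them is either an edge or a
  non-edge.\<close>

lemma spanned_triple_add:
  assumes "t \<in> triples V"
  shows "spanned E t + spanned (pairs V - E) t = 3"
proof -
  have t: "finite t" "card t = 3" "t \<subseteq> V"
    using assms by (auto simp: triples_def intro: card_ge_0_finite)
  have "spanned E t + spanned (pairs V - E) t
      = card ({e \<in> E. e \<subseteq> t} \<union> {e \<in> pairs V - E. e \<subseteq> t})"
    unfolding spanned_def using finite_E finite_pairs by (subst card_Un_disjoint) auto
  also have "{e \<in> E. e \<subseteq> t} \<union> {e \<in> pairs V - E. e \<subseteq> t} = {e. e \<subseteq> t \<and> card e = 2}"
    using E_pairs t by (auto simp: pairs_def)
  also have "card \<dots> = 3"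
    using n_subsets[OF t(1), of 2] t by (simp add: choose_two)
  finally show ?thesis .
qed

text \<open>Double counting of incidences between edges and triples: an edge extends to a triple by
  any one of the vertices off it, and different vertices give different triples.\<close>

lemma sum_spanned_triples: "(\<Sum>t \<in> triples V. spanned E t) = card E * (card V - 2)"
proof -
  have "card {t \<in> triples V. e \<subseteq> t} = card V - 2" if "e \<in> E" for e
  proof -
    have e: "e \<in> pairs V" using that E_pairs by auto
    then have fe: "finite e" "e \<subseteq> V" "card e = 2"
      by (auto simp: pairs_def intro: card_ge_0_finite)
    have "{t \<in> triples V. e \<subseteq> t} = (\<lambda>w. insert w e) ` (V - e)"
    proof
      show "{t \<in> triples V. e \<subseteq> t} \<subseteq> (\<lambda>w. insert w e) ` (V - e)"
      proof
        fix t assume "t \<in> {t \<in> triples V. e \<subseteq> t}"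
        then have t: "t \<subseteq> V" "card t = 3" "e \<subseteq> t" by (auto simp: triples_def)
        then have "card (t - e) = 1" using fe by (simp add: card_Diff_subset)
        then obtain w where "t - e = {w}" by (auto simp: card_1_singleton_iff)
        then show "t \<in> (\<lambda>w. insert w e) ` (V - e)" using t by (intro image_eqI[of _ _ w]) auto
      qed
    qed (use e insert_in_triples in auto)
    moreover have "inj_on (\<lambda>w. insert w e) (V - e)" by (auto simp: inj_on_def)
    ultimately show ?thesis using fe by (simp add: card_image card_Diff_subset)
  qed
  then have "(\<Sum>e \<in> E. card {t \<in> triples V. e \<subseteq> t}) = card E * (card V - 2)" by simp
  moreover have "(\<Sum>t \<in> triples V. spanned E t) = (\<Sum>e \<in> E. card {t \<in> triples V. e \<subseteq> t})"
    unfolding spanned_def using finite_triples finite_E by (rule sum_multicount_gen) simp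
  ultimately show ?thesis by simp
qed

end

section \<open>Counting one-edge sets in triangle-free edge sets and their complements\<close>

locale triangle_free_edge_set = edge_set +
  assumes triangle_free: "t \<in> triples V \<Longrightarrow> spanned E t \<le> 2"
begin

text \<open>Without triangles \<open>spanned E t\<close> is 0, 1 or 2, so the incidence sum splits
  into these two classes, weighted by 1 and 2.\<close>

lemma count_triples:
  "card {t \<in> triples V. spanned E t = 1} + 2 * card {t \<in> triples V. spanned E t = 2}
    = card E * (card V - 2)"
proof -
  have "(\<Sum>t \<in> triples V. spanned E t)
      = (\<Sum>t \<in> triples V. (if spanned E t = 1 then 1 else 0) + 2 * (if spanned E t = 2 then 1 else 0))"
  proof (rule sum.cong)
    fix t assume "t \<in> triples V"
    from triangle_free[OF this] show "spanned E t
        = (if spanned E t = 1 then 1 else 0) + 2 * (if spanned E t = 2 then 1 else 0)"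
      by (cases "spanned E t") auto
  qed simp
  also have "\<dots> = card {t \<in> triples V. spanned E t = 1} + 2 * card {t \<in> triples V. spanned E t = 2}"
    using finite_triples by (simp add: sum.distrib flip: sum_distrib_left sum.inter_filter)
  finally show ?thesis by (simp add: sum_spanned_triples)
qed

lemma spanned_compl: "t \<in> triples V \<Longrightarrow> spanned (pairs V - E) t = 1 \<longleftrightarrow> spanned E t = 2"
  using spanned_triple_add[of t] by auto

lemma complement_edge_set: "edge_set V (pairs V - E)"
  using finite_V by unfold_locales auto

text \<open>Sets of size 2 and 3 suffice for the lower bound. The triples for the complement are
  those with two edges, hence with a single non-edge.\<close>

lemma one_edge_sets_lower:
  "E \<union> {t \<in> triples V. spanned E t = 1} \<subseteq> one_edge_sets V E"
  "(pairs V - E) \<union> {t \<in> triples V. spanned E t = 2} \<subseteq> one_edge_sets V (pairs V - E)"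
  using spanned_pair edge_set.spanned_pair[OF complement_edge_set] E_pairs spanned_compl
  unfolding one_edge_sets_def
  by (auto simp: triples_def) (auto simp: pairs_def)

text \<open>Both unions are disjoint because their parts consist of sets of different sizes, and
  edges and non-edges together exhaust \<open>pairs V\<close>.\<close>

lemma card_lower:
  "card (E \<union> {t \<in> triples V. spanned E t = 1})
    + card ((pairs V - E) \<union> {t \<in> triples V. spanned E t = 2})
    = (card V choose 2) + card {t \<in> triples V. spanned E t = 1} + card {t \<in> triples V. spanned E t = 2}"
proof -
  have disj: "P \<inter> {t \<in> triples V. Q t} = {}" if "P \<subseteq> pairs V" for P Q
    using that by (auto simp: pairs_def triples_def)
  have "card E + card (pairs V - E) = card V choose 2"
    using finite_E E_pairs finite_pairs finite_V
    by (metis card_Diff_subset card_mono card_pairs le_add_diff_inverse)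
  then show ?thesis
    using finite_E finite_pairs finite_triples disj[OF E_pairs] disj[of "pairs V - E"]
    by (simp add: card_Un_disjoint)
qed

lemma finite_one_edge_sets: "finite (one_edge_sets V F)"
  using finite_V unfolding one_edge_sets_def by simp

lemma count_lower:
  "(card V choose 2) + card {t \<in> triples V. spanned E t = 1} + card {t \<in> triples V. spanned E t = 2}
    \<le> card (one_edge_sets V E) + card (one_edge_sets V (pairs V - E))"
  unfolding card_lower[symmetric]
  by (intro add_mono card_mono finite_one_edge_sets one_edge_sets_lower)

text \<open>Converse to \<open>one_edge_sets_lower\<close> when \<open>t\<^sub>1 = 0\<close>. A
  larger set with a single edge would contain a one-edge triple; a set with a single non-edge and
  two vertices off it would contain a triangle.\<close>

lemma one_edge_sets_eq:
  assumes none: "\<And>t. t \<in> triples V \<Longrightarrow> spanned E t \<noteq> 1"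
  shows "one_edge_sets V E \<subseteq> E"
    and "one_edge_sets V (pairs V - E) \<subseteq> (pairs V - E) \<union> {t \<in> triples V. spanned E t = 2}"
proof -
  show "one_edge_sets V E \<subseteq> E"
  proof
    fix S assume "S \<in> one_edge_sets V E"
    then have S: "S \<subseteq> V" "spanned E S = 1" by (auto simp: one_edge_sets_def)
    then obtain e where e: "{f \<in> E. f \<subseteq> S} = {e}"
      by (auto simp: spanned_def card_1_singleton_iff)
    then have eE: "e \<in> E" "e \<subseteq> S" by auto
    show "S \<in> E"
    proof (rule ccontr)
      assume "S \<notin> E"
      then obtain w where w: "w \<in> S" "w \<notin> e" using eE by (metis subsetI subset_antisym)
      have t: "insert w e \<in> triples V" using eE w S E_pairs by (intro insert_in_triples) auto
      \<comment> \<open>Monotonicity squeezes the triple between \<open>e\<close> and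
        \<open>S\<close>, both of which span exactly one edge.\<close>
      have "spanned E e \<le> spanned E (insert w e)" "spanned E (insert w e) \<le> spanned E S"
        using w eE by (auto intro: spanned_mono)
      then show False using none[OF t] S spanned_pair[of e] eE E_pairs by auto
    qed
  qed
  show "one_edge_sets V (pairs V - E) \<subseteq> (pairs V - E) \<union> {t \<in> triples V. spanned E t = 2}"
  proof
    fix S assume "S \<in> one_edge_sets V (pairs V - E)"
    then have S: "S \<subseteq> V" "spanned (pairs V - E) S = 1" by (auto simp: one_edge_sets_def)
    then obtain e where e: "{f \<in> pairs V - E. f \<subseteq> S} = {e}"
      by (auto simp: spanned_def card_1_singleton_iff)
    then have eE: "e \<in> pairs V" "e \<notin> E" "e \<subseteq> S" by auto
    show "S \<in> (pairs V - E) \<union> {t \<in> triples V. spanned E t = 2}"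
    proof (cases "S = e")
      case False
      then obtain w where w: "w \<in> S" "w \<notin> e" using eE by auto
      have t: "insert w e \<in> triples V" using eE w S by (intro insert_in_triples) auto
      show ?thesis
      proof (cases "S = insert w e")
        case True
        then show ?thesis using t S spanned_compl by auto
      next
        case False
        then obtain x where x: "x \<in> S" "x \<notin> e" "x \<noteq> w" using w eE by auto
        obtain a b where ab: "e = {a, b}" "a \<noteq> b" using eE(1) by (rule pairsE)
        \<comment> \<open>Leaving out the end \<open>b\<close> avoids the only non-edge of
          \<open>S\<close>, so all three pairs of this triple are edges.\<close>
        let ?t = "{a, w, x}"
        have t': "?t \<in> triples V"
          using ab w x eE S by (auto simp: triples_def)
        have "{f \<in> pairs V - E. f \<subseteq> ?t} \<subseteq> {e}" using ab w x eE by (subst e[symmetric]) auto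
        moreover have "\<not> e \<subseteq> ?t" using ab w x by auto
        ultimately have "{f \<in> pairs V - E. f \<subseteq> ?t} = {}" by auto
        then have "spanned (pairs V - E) ?t = 0" by (simp only: spanned_def card.empty)
        then show ?thesis using spanned_triple_add[OF t'] triangle_free[OF t'] by auto
      qed
    qed (use eE in auto)
  qed
qed

lemma count_eq:
  assumes none: "\<And>t. t \<in> triples V \<Longrightarrow> spanned E t \<noteq> 1"
  shows "card (one_edge_sets V E) + card (one_edge_sets V (pairs V - E))
    = (card V choose 2) + card {t \<in> triples V. spanned E t = 2}"
proof -
  have "{t \<in> triples V. spanned E t = 1} = {}" using none by blast
  then have "card {t \<in> triples V. spanned E t = 1} = 0" by (simp only: card.empty)
  moreover have "one_edge_sets V E = E \<union> {t \<in> triples V. spanned E t = 1}"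
    using one_edge_sets_eq(1)[OF none] one_edge_sets_lower(1) by blast
  moreover have "one_edge_sets V (pairs V - E) = (pairs V - E) \<union> {t \<in> triples V. spanned E t = 2}"
    using one_edge_sets_eq(2)[OF none] one_edge_sets_lower(2) by blast
  ultimately show ?thesis using card_lower by (simp only: add_0_right)
qed

end

section \<open>The lower bound and its equality condition for edge sets\<close>

text \<open>Twice the identity \<open>(n choose 2) + (n - 1 choose 2) = (n - 1)\<^sup>2\<close>;
  doubling avoids division in the natural numbers.\<close>

lemma twice_square_decomp:
  assumes "0 < n"
  shows "2 * (n choose 2) + (n - 1) * (n - 2) = 2 * (n - 1)\<^sup>2"
proof (cases "n = 1")
  case False
  then obtain m where "n = m + 2" using assms by (intro that[of "n - 2"]) simp
  moreover from this have "even (n * (n - 1))" by simp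
  then have "2 * (n choose 2) = n * (n - 1)" by (simp add: choose_two)
  ultimately show ?thesis by (simp add: algebra_simps power2_eq_square)
qed auto

text \<open>Twice the total is at least
  \<open>2 * (n choose 2) + t\<^sub>1 + (t\<^sub>1 + 2 * t\<^sub>2)\<close>. The last bracket is at
  least \<open>(n - 1) * (n - 2)\<close>, so twice the total exceeds
  \<open>2 * (n - 1)\<^sup>2\<close> by at least \<open>t\<^sub>1\<close>.\<close>

lemma (in triangle_free_edge_set) nordhaus_gaddum:
  assumes "0 < card V" and "card V \<le> Suc (card E)"
  shows "(card V - 1)\<^sup>2 \<le> card (one_edge_sets V E) + card (one_edge_sets V (pairs V - E))"
    and "card (one_edge_sets V E) + card (one_edge_sets V (pairs V - E)) = (card V - 1)\<^sup>2
      \<Longrightarrow> t \<in> triples V \<Longrightarrow> spanned E t \<noteq> 1"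
proof -
  let ?A = "card {t \<in> triples V. spanned E t = 1}"
  let ?s = "card (one_edge_sets V E) + card (one_edge_sets V (pairs V - E))"
  have "(card V - 1) * (card V - 2) \<le> card E * (card V - 2)"
    using assms by (intro mult_right_mono) auto
  \<comment> \<open>Replacing products, squares and cardinalities by variables makes the argument
    linear: \<open>a\<close> and \<open>b\<close> stand for \<open>t\<^sub>1\<close> and
    \<open>t\<^sub>2\<close>, \<open>c\<close> for \<open>card V choose 2\<close>, \<open>r\<close>
    for the incidence sum.\<close>
  moreover have "q \<le> s \<and> (s = q \<longrightarrow> a = 0)"
    if "p \<le> r" "a + 2 * b = r" "c + a + b \<le> s" "2 * c + p = 2 * q" for p q r a b c s :: nat
    using that by linarith
  ultimately have *: "(card V - 1)\<^sup>2 \<le> ?s \<and> (?s = (card V - 1)\<^sup>2 \<longrightarrow> ?A = 0)"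
    using count_triples count_lower twice_square_decomp[OF assms(1)] by blast
  then show "(card V - 1)\<^sup>2 \<le> ?s" by (rule conjunct1)
  assume "?s = (card V - 1)\<^sup>2" and t: "t \<in> triples V"
  then have "?A = 0" using * by blast
  then have "{t \<in> triples V. spanned E t = 1} = {}" using finite_triples by simp
  then show "spanned E t \<noteq> 1" using t by blast
qed

section \<open>Undirected graphs\<close>

lemma undirected_edges_with_proj:
  "undirected_edges (with_proj G) = {{u, v} |u v. (u, v) \<in> parcs G}"
  by (force simp: undirected_edges_def)

lemma undirected_edges_induced:
  "undirected_edges (with_proj G \<restriction> S) = {e \<in> undirected_edges (with_proj G). e \<subseteq> S}"
  by (auto simp: undirected_edges_def induce_subgraph_def)

text \<open>The bridge from induced subgraphs to the edge-set counts above.\<close>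

lemma sigma1_eq: "sigma1 G = card (one_edge_sets (pverts G) (undirected_edges (with_proj G)))"
  by (simp add: sigma1_def one_nearly_independent_def one_edge_sets_def spanned_def
      undirected_edges_induced)

lemma (in pair_graph) edge_set_undirected_edges:
  "edge_set (pverts G) (undirected_edges (with_proj G))"
  using pair_finite_verts in_arcsD1 in_arcsD2 no_loops'
  by unfold_locales (auto simp: undirected_edges_with_proj pairs_def card_insert_if)

lemma (in pair_graph) in_undirected_edges_iff:
  "{u, v} \<in> undirected_edges (with_proj G) \<longleftrightarrow> (u, v) \<in> parcs G"
  using arcs_symmetric by (auto simp: undirected_edges_with_proj doubleton_eq_iff)

lemma (in pair_graph) undirected_edges_complement:
  "undirected_edges (with_proj (complement G)) = pairs (pverts G) - undirected_edges (with_proj G)"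
proof (intro set_eqI iffI)
  fix e assume "e \<in> undirected_edges (with_proj (complement G))"
  then obtain u v where "e = {u, v}" "u \<in> pverts G" "v \<in> pverts G" "u \<noteq> v" "(u, v) \<notin> parcs G"
    by (auto simp: undirected_edges_with_proj complement_def)
  then show "e \<in> pairs (pverts G) - undirected_edges (with_proj G)"
    using in_undirected_edges_iff by (auto simp: pairs_def)
next
  fix e assume e: "e \<in> pairs (pverts G) - undirected_edges (with_proj G)"
  then obtain u v where "e = {u, v}" "u \<noteq> v" "u \<in> pverts G" "v \<in> pverts G"
    by (auto elim: pairsE)
  then show "e \<in> undirected_edges (with_proj (complement G))"
    using e in_undirected_edges_iff[of u v]
    unfolding undirected_edges_with_proj[of "complement G"] by (auto simp: complement_def)
qed

section \<open>The number of edges of a connected graph\<close>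

text \<open>A vertex set is grown from \<open>r\<close> one vertex at a time; each new vertex is
  joined by an edge that the earlier set did not contain.\<close>

lemma card_le_Suc_card_edges:
  assumes fin: "finite V" and R: "R \<subseteq> V \<times> V" and r: "r \<in> V"
    and reach: "\<And>v. v \<in> V \<Longrightarrow> (r, v) \<in> R\<^sup>*"
  shows "card V \<le> Suc (card ((\<lambda>(u, v). {u, v}) ` R))"
proof -
  let ?E = "(\<lambda>(u, v). {u, v}) ` R"
  have finE: "finite ?E" using fin R by (meson finite_SigmaI finite_imageI finite_subset)
  have "\<exists>A. r \<in> A \<and> A \<subseteq> V \<and> card A = Suc k \<and> k \<le> card {e \<in> ?E. e \<subseteq> A}" if "k < card V" for k
    using that
  proof (induction k)
    case 0
    then show ?case using r by (intro exI[of _ "{r}"]) auto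
  next
    case (Suc k)
    then obtain A where A: "r \<in> A" "A \<subseteq> V" "card A = Suc k" "k \<le> card {e \<in> ?E. e \<subseteq> A}"
      by auto
    \<comment> \<open>Otherwise \<open>A\<close> is closed under \<open>R\<close> and contains
      everything reachable from \<open>r\<close>, although it is still smaller than
      \<open>V\<close>.\<close>
    have "\<exists>a b. (a, b) \<in> R \<and> a \<in> A \<and> b \<notin> A"
    proof (rule ccontr)
      assume closed: "\<not> ?thesis"
      have "v \<in> A" if "(r, v) \<in> R\<^sup>*" for v
        using that by induction (use A closed in auto)
      then have "A = V" using reach A by auto
      then show False using Suc.prems A by simp
    qed
    then obtain a b where ab: "(a, b) \<in> R" "a \<in> A" "b \<notin> A" by blast
    have finA: "finite A" using A fin finite_subset by blast
    have "Suc (card {e \<in> ?E. e \<subseteq> A}) = card (insert {a, b} {e \<in> ?E. e \<subseteq> A})"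
      using finE ab by (subst card_insert_disjoint) auto
    also have "\<dots> \<le> card {e \<in> ?E. e \<subseteq> insert b A}"
      using finE ab by (intro card_mono) (auto intro: rev_image_eqI)
    finally have "Suc k \<le> card {e \<in> ?E. e \<subseteq> insert b A}" using A by simp
    then show ?case using A ab R finA by (intro exI[of _ "insert b A"]) auto
  qed
  moreover have "card V - 1 < card V" using fin r card_gt_0_iff[of V] by auto
  ultimately obtain A where "card V - 1 \<le> card {e \<in> ?E. e \<subseteq> A}" by blast
  also have "\<dots> \<le> card ?E" using finE by (intro card_mono) auto
  finally show ?thesis by linarith
qed

text \<open>Symmetry of the arcs turns connectedness into strong connectedness, so any vertex can
  serve as the root from which all others are reachable.\<close>

lemma (in pair_graph) card_verts_le_Suc_card_edges:
  assumes "connected (with_proj G)"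
  shows "pverts G \<noteq> {}" and "card (pverts G) \<le> Suc (card (undirected_edges (with_proj G)))"
proof -
  have sc: "strongly_connected (with_proj G)"
    using symmetric_connected_imp_strongly_connected pair_sym_arcs assms by blast
  then show "pverts G \<noteq> {}" by (simp add: strongly_connected_def)
  then obtain r where r: "r \<in> pverts G" by auto
  have "(r, v) \<in> (parcs G)\<^sup>*" if "v \<in> pverts G" for v
  proof -
    have "r \<rightarrow>\<^sup>*\<^bsub>with_proj G\<^esub> v" using sc r that by (simp add: strongly_connected_def)
    from reachable_rtranclI[OF this] show ?thesis by simp
  qed
  moreover have "parcs G \<subseteq> pverts G \<times> pverts G" using in_arcsD1 in_arcsD2 by auto
  ultimately have "card (pverts G) \<le> Suc (card ((\<lambda>(u, v). {u, v}) ` parcs G))"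
    using card_le_Suc_card_edges[OF pair_finite_verts _ r] by blast
  then show "card (pverts G) \<le> Suc (card (undirected_edges (with_proj G)))"
    by (simp add: undirected_edges_def case_prod_beta')
qed

section \<open>Trees: absence of short cycles and edges inside triples\<close>

locale undirected_tree_graph = pair_graph +
  assumes is_tree: "undirected_tree G"
begin

lemma no_long_cycle: "cycle p \<Longrightarrow> length p < 3"
  using is_tree by (force simp: undirected_tree_def)

lemma no_triangle: "(a, b) \<in> parcs G \<Longrightarrow> (b, c) \<in> parcs G \<Longrightarrow> (c, a) \<in> parcs G \<Longrightarrow> False"
  using no_long_cycle[of "[(a, b), (b, c), (c, a)]"] no_loops' in_arcsD1
  by (fastforce simp: cycle_def awalk_def)

text \<open>Adjacent vertices differ as there are no loops; the two inequalities between opposite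
  vertices make all four distinct.\<close>

lemma no_4_cycle:
  "(a, b) \<in> parcs G \<Longrightarrow> (b, c) \<in> parcs G \<Longrightarrow> (c, d) \<in> parcs G \<Longrightarrow> (d, a) \<in> parcs G \<Longrightarrow>
    a \<noteq> c \<Longrightarrow> b \<noteq> d \<Longrightarrow> False"
  using no_long_cycle[of "[(a, b), (b, c), (c, d), (d, a)]"] no_loops' in_arcsD1
  by (fastforce simp: cycle_def awalk_def)

text \<open>This turns statements about the number of edges in a triple into propositional
  statements about three adjacencies.\<close>

lemma spanned_triple:
  assumes "a \<noteq> b" "a \<noteq> c" "b \<noteq> c"
  shows "spanned (undirected_edges (with_proj G)) {a, b, c}
    = of_bool ((a, b) \<in> parcs G) + of_bool ((b, c) \<in> parcs G) + of_bool ((c, a) \<in> parcs G)"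
proof -
  let ?E = "undirected_edges (with_proj G)"
  have two: "card e = 2" if "e \<in> ?E" for e
    using that edge_set_undirected_edges by (auto simp: edge_set_def pairs_def)
  have "{e \<in> ?E. e \<subseteq> {a, b, c}} = {e \<in> {{a, b}, {b, c}, {c, a}}. e \<in> ?E}"
  proof -
    have "e \<in> {{a, b}, {b, c}, {c, a}}" if "e \<in> ?E" "e \<subseteq> {a, b, c}" for e
      using two[OF that(1)] that(2) by (fastforce simp: card_2_iff)
    then show ?thesis by auto
  qed
  moreover have "distinct [{a, b}, {b, c}, {c, a}]"
    using assms by (auto simp: doubleton_eq_iff)
  ultimately show ?thesis
    unfolding spanned_def
    by (simp add: Collect_conv_if Collect_disj_eq conj_disj_distribR in_undirected_edges_iff)
      (auto simp: doubleton_eq_iff)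
qed

sublocale triangle_free_edge_set "pverts G" "undirected_edges (with_proj G)"
proof -
  interpret edge_set "pverts G" "undirected_edges (with_proj G)" by (rule edge_set_undirected_edges)
  show "triangle_free_edge_set (pverts G) (undirected_edges (with_proj G))"
  proof
    fix t assume "t \<in> triples (pverts G)"
    then obtain a b c where "t = {a, b, c}" "a \<noteq> b" "a \<noteq> c" "b \<noteq> c" by (rule triplesE)
    then show "spanned (undirected_edges (with_proj G)) t \<le> 2"
      using spanned_triple[of a b c] no_triangle[of a b c] by (auto simp: of_bool_def)
  qed
qed

section \<open>Stars and the equality case\<close>

definition star_at :: "'a \<Rightarrow> bool" where
  "star_at c \<longleftrightarrow> c \<in> pverts G \<and> parcs G = {c} \<times> (pverts G - {c}) \<union> (pverts G - {c}) \<times> {c}"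

text \<open>An arc between two vertices other than \<open>c\<close> would close a triangle with
  \<open>c\<close>.\<close>

lemma star_atI:
  assumes "c \<in> pverts G" and "\<And>w. w \<in> pverts G \<Longrightarrow> w \<noteq> c \<Longrightarrow> (c, w) \<in> parcs G"
  shows "star_at c"
proof -
  have "x = c \<or> y = c" if "(x, y) \<in> parcs G" for x y
    using that assms no_triangle[of c x y] in_arcsD1 in_arcsD2 arcs_symmetric by metis
  then have "parcs G \<subseteq> {c} \<times> (pverts G - {c}) \<union> (pverts G - {c}) \<times> {c}"
    using in_arcsD1 in_arcsD2 no_loops' by fastforce
  moreover have "{c} \<times> (pverts G - {c}) \<union> (pverts G - {c}) \<times> {c} \<subseteq> parcs G"
    using assms arcs_symmetric by blast
  ultimately show ?thesis
    using assms(1) unfolding star_at_def by blast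
qed

lemma connected: "Digraph_Component.connected (with_proj G)"
  using is_tree by (simp add: undirected_tree_def)

text \<open>Every vertex off an edge is adjacent to one of its ends. If neither end of the edge
  \<open>uv\<close> were a centre, some \<open>x\<close> would miss \<open>v\<close> and some
  \<open>y\<close> would miss \<open>u\<close>, which leads to the 4-cycle \<open>u\<close>,
  \<open>v\<close>, \<open>y\<close>, \<open>x\<close>.\<close>

lemma star_if_no_single_edge_triple:
  assumes none: "\<And>t. t \<in> triples (pverts G) \<Longrightarrow> spanned (undirected_edges (with_proj G)) t \<noteq> 1"
  shows "\<exists>c. star_at c"
proof (cases "parcs G = {}")
  case True
  \<comment> \<open>A connected graph without edges has a single vertex, the degenerate
    star.\<close>
  then have "card (pverts G) \<le> 1"
    using card_verts_le_Suc_card_edges(2)[OF connected] by (simp add: undirected_edges_def)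
  moreover obtain c where c: "c \<in> pverts G"
    using card_verts_le_Suc_card_edges(1)[OF connected] by auto
  ultimately have "pverts G = {c}"
    using pair_finite_verts by (auto simp: card_le_Suc0_iff_eq)
  then show ?thesis using True by (auto simp: star_at_def)
next
  case False
  then obtain u v where uv: "(u, v) \<in> parcs G" by auto
  have adj: "(x, w) \<in> parcs G \<or> (y, w) \<in> parcs G"
    if "(x, y) \<in> parcs G" "w \<in> pverts G" "w \<noteq> x" "w \<noteq> y" for x y w
  proof -
    have ne: "x \<noteq> y" "x \<noteq> w" "y \<noteq> w" using that no_loops' by auto
    then have "{x, y, w} \<in> triples (pverts G)"
      using that in_arcsD1 in_arcsD2 by (auto simp: triples_def)
    from none[OF this] show ?thesis
      using spanned_triple[OF ne] that arcs_symmetric by (auto simp: of_bool_def split: if_splits)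
  qed
  have "star_at u \<or> star_at v"
  proof (rule ccontr)
    assume "\<not> ?thesis"
    then obtain x y where x: "x \<in> pverts G" "x \<noteq> v" "(v, x) \<notin> parcs G"
      and y: "y \<in> pverts G" "y \<noteq> u" "(u, y) \<notin> parcs G"
      using star_atI in_arcsD1[OF uv] in_arcsD2[OF uv] by metis
    have "x \<noteq> u" "y \<noteq> v" using x y uv arcs_symmetric by auto
    then have ux: "(u, x) \<in> parcs G" and vy: "(v, y) \<in> parcs G"
      using adj[OF uv] x y by auto
    \<comment> \<open>The vertex \<open>y\<close> lies off the edge \<open>ux\<close> and is not
      adjacent to \<open>u\<close>, so it must be adjacent to \<open>x\<close>.\<close>
    then have "(x, y) \<in> parcs G" using adj[OF ux, of y] x y by auto
    then show False
      using no_4_cycle[OF uv vy, of x] ux \<open>y \<noteq> u\<close> x arcs_symmetric by auto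
  qed
  then show ?thesis by blast
qed

text \<open>A triple through the centre spans two edges, any other triple none.\<close>

lemma star_no_single_edge_triple:
  assumes c: "star_at c" and t: "t \<in> triples (pverts G)"
  shows "spanned (undirected_edges (with_proj G)) t \<noteq> 1"
proof -
  obtain x y z where "t = {x, y, z}" "x \<noteq> y" "x \<noteq> z" "y \<noteq> z"
    "x \<in> pverts G" "y \<in> pverts G" "z \<in> pverts G"
    using t by (rule triplesE)
  then show ?thesis
    using spanned_triple[of x y z] c by (auto simp: star_at_def of_bool_def)
qed

lemma star_card_edges:
  assumes "star_at c"
  shows "card (undirected_edges (with_proj G)) = card (pverts G) - 1"
proof -
  have "undirected_edges (with_proj G) = (\<lambda>v. {c, v}) ` (pverts G - {c})"
    using assms by (auto simp: undirected_edges_with_proj star_at_def)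
  moreover have "inj_on (\<lambda>v. {c, v}) (pverts G - {c})"
    by (auto simp: inj_on_def doubleton_eq_iff)
  ultimately show ?thesis
    using assms by (simp add: card_image star_at_def)
qed

text \<open>The centre is the preimage of \<open>Inl 0\<close>, the only vertex on the left
  side.\<close>

lemma star_if_iso:
  assumes "digraph_iso (with_proj G) (with_proj (complete_bipartite 1 m))"
  shows "\<exists>c. star_at c"
proof -
  let ?K = "complete_bipartite 1 m"
  obtain f where f: "digraph_isomorphism f" and K: "with_proj ?K = app_iso f (with_proj G)"
    using assms by (auto simp: digraph_iso_def)
  let ?h = "iso_verts f"
  have "pverts ?K = ?h ` pverts G" using arg_cong[OF K, of verts] by simp
  then have "Inl 0 \<in> ?h ` pverts G" by (auto simp: complete_bipartite_def)
  then obtain c where c: "c \<in> pverts G" "?h c = Inl 0" by auto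
  have h: "inj_on ?h (pverts G)" using f by (simp add: digraph_isomorphism_def)
  \<comment> \<open>Passing to arc ends describes the arcs of \<open>?K\<close> by the vertex map
    alone, whatever the arc map of \<open>f\<close> is.\<close>
  have parcs_K: "parcs ?K = (\<lambda>(u, v). (?h u, ?h v)) ` parcs G"
    using arg_cong[OF K, of arcs_ends] arcs_ends_app_iso_eq[OF f] by simp
  have "(c, w) \<in> parcs G" if w: "w \<in> pverts G" "w \<noteq> c" for w
  proof -
    have "?h w \<noteq> ?h c" using h w c by (metis inj_onD)
    moreover have "?h w \<in> pverts ?K" using \<open>pverts ?K = _\<close> w by auto
    ultimately have "(?h c, ?h w) \<in> parcs ?K" using c by (auto simp: complete_bipartite_def)
    then obtain u v where uv: "(u, v) \<in> parcs G" "?h u = ?h c" "?h v = ?h w"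
      unfolding parcs_K by auto
    then have "u = c" "v = w"
      using inj_onD[OF h] in_arcsD1 in_arcsD2 w(1) c(1) by blast+
    then show ?thesis using uv by simp
  qed
  then show ?thesis using star_atI c by blast
qed

lemma iso_if_star:
  assumes "star_at c"
  shows "digraph_iso (with_proj G) (with_proj (complete_bipartite 1 (card (pverts G) - 1)))"
proof -
  let ?n = "card (pverts G) - 1"
  have c: "c \<in> pverts G" and E: "parcs G = {c} \<times> (pverts G - {c}) \<union> (pverts G - {c}) \<times> {c}"
    using assms by (auto simp: star_at_def)
  have "card (pverts G - {c}) = card {..<?n}" using c by simp
  then obtain g where g: "bij_betw g (pverts G - {c}) {..<?n}"
    using finite_same_card_bij[of "pverts G - {c}" "{..<?n}"] pair_finite_verts by auto
  \<comment> \<open>The centre goes to the only left vertex; the leaves are numbered on the right by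
    \<open>g\<close>.\<close>
  define h :: "'a \<Rightarrow> nat + nat" where "h v = (if v = c then Inl 0 else Inr (g v))" for v
  have him: "h ` (pverts G - {c}) = Inr ` {..<?n}"
    using bij_betw_imp_surj_on[OF g] by (auto simp: h_def image_iff)
  have hc: "h c = Inl 0" by (simp add: h_def)
  have inj: "inj_on h (pverts G)"
    using bij_betw_imp_inj_on[OF g] by (auto simp: h_def inj_on_def)
  define f where "f = \<lparr> iso_verts = h, iso_arcs = map_prod h h, iso_head = snd, iso_tail = fst \<rparr>"
  have "parcs G \<subseteq> pverts G \<times> pverts G" using in_arcsD1 in_arcsD2 by auto
  then have "inj_on (map_prod h h) (parcs G)"
    using map_prod_inj_on[OF inj inj] inj_on_subset by blast
  then have "digraph_isomorphism f"
    using inj wf_digraph by (auto simp: digraph_isomorphism_def f_def)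
  moreover have "with_proj (complete_bipartite 1 ?n) = app_iso f (with_proj G)"
  proof -
    have "h ` pverts G = {Inl 0} \<union> Inr ` {..<?n}"
      using him hc c by (metis image_insert insert_Diff insert_is_Un)
    moreover have "map_prod h h ` parcs G
        = {Inl 0} \<times> Inr ` {..<?n} \<union> Inr ` {..<?n} \<times> {Inl 0}"
      by (simp add: E image_Un map_prod_surj_on[OF _ him] map_prod_surj_on[OF him] hc)
    ultimately show ?thesis
      by (simp add: with_proj_def app_iso_def f_def complete_bipartite_def lessThan_Suc Let_def)
  qed
  ultimately show ?thesis by (auto simp: digraph_iso_def)
qed

end

section \<open>The bound for trees and both directions of the equality case\<close>

theorem theorem3:
  fixes T :: "'a pair_pre_digraph" and n :: nat
  assumes "undirected_tree T" and "card (pverts T) = n"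
  shows "sigma1 T + sigma1 (complement T) \<ge> (n - 1)\<^sup>2 \<and>
    (sigma1 T + sigma1 (complement T) = (n - 1)\<^sup>2 \<longleftrightarrow>
      digraph_iso (with_proj T) (with_proj (complete_bipartite 1 (n - 1))))"
proof -
  interpret undirected_tree_graph T
    using assms(1) by (simp add: undirected_tree_graph_def undirected_tree_graph_axioms_def
        undirected_tree_def)
  let ?E = "undirected_edges (with_proj T)"
  let ?s = "sigma1 T + sigma1 (complement T)"
  have s: "?s = card (one_edge_sets (pverts T) ?E)
      + card (one_edge_sets (pverts T) (pairs (pverts T) - ?E))"
    \<comment> \<open>The edges of the complement are rewritten before \<open>complement\<close> is
      unfolded; the unfolding then only identifies the vertex sets.\<close>
    by (simp add: sigma1_eq undirected_edges_complement) (simp add: complement_def)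
  have pos: "0 < card (pverts T)" and edges: "card (pverts T) \<le> Suc (card ?E)"
    using card_verts_le_Suc_card_edges[OF connected] pair_finite_verts by auto
  note bound = nordhaus_gaddum[OF pos edges, folded s]
  \<comment> \<open>For a star \<open>t\<^sub>1 = 0\<close> and there are exactly
    \<open>n - 1\<close> edges, so \<open>count_triples\<close> determines \<open>t\<^sub>2\<close>
    and \<open>count_eq\<close> gives the total exactly.\<close>
  have "?s = (card (pverts T) - 1)\<^sup>2" if "star_at c" for c
  proof -
    note none = star_no_single_edge_triple[OF that]
    then have "{t \<in> triples (pverts T). spanned ?E t = 1} = {}" by blast
    then have "card {t \<in> triples (pverts T). spanned ?E t = 1} = 0" by (simp only: card.empty)
    then have "2 * card {t \<in> triples (pverts T). spanned ?E t = 2}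
        = (card (pverts T) - 1) * (card (pverts T) - 2)"
      using count_triples star_card_edges[OF that] by simp
    then show ?thesis
      using count_eq[OF none] s twice_square_decomp[OF pos] by linarith
  qed
  then show ?thesis
    using bound star_if_no_single_edge_triple star_if_iso iso_if_star assms(2) by blast
qed

end
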